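(* For integers $m,n\ge 1$, the number of interior nodes in $BC_{GP}(m,n)$ is $$\frac14\left\{ (m+n)(m+n-1)^2(m+n-4) + 2mn(2m+n-1)(m+2n-1)\right\}.$$
   Context: For integers $m,n\ge 1$, the planar graph $BC(m,n)$ is constructed as follows: take a rectangle of size $m\times n$, divide each of the two vertical sides into $m$ equal parts by $m-1$ nodes and each of the two horizontal sides into $n$ equal parts by $n-1$ nodes, giving, with the four vertices, $2(m+n)$ boundary nodes; join every pair of boundary nodes by a straight line segment (a chord). $BC_{GP}(m,n)$ ("general position") denotes a graph obtained in the same way after perturbing the boundary nodes other than the four vertices of the rectangle by small (random, independent) displacements along the sides on which they lie. The displacements are small enough that the nodes stay in the interior of their sides and keep their order, and they are such that no interior point of the rectangle lies on three or more chords. The nodes of the graph are the $2(m+n)$ boundary nodes together with the interior nodes, i.e. the points of the interior of the rectangle at which two chords intersect. *)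

theory Defs
  imports "HOL-Analysis.Analysis"
begin

text \<open>
  The rectangle has height \<open>m\<close> and width \<open>n\<close>, so that the unperturbed boundary nodes are
  spaced at unit distance: the two vertical sides are cut into \<open>m\<close> parts, the two horizontal
  ones into \<open>n\<close> parts.
\<close>

definition rectangle :: "nat \<Rightarrow> nat \<Rightarrow> (real \<times> real) set" where
  "rectangle m n = cbox (0, 0) (real n, real m)"

datatype side = Left_Side | Right_Side | Bottom_Side | Top_Side

fun num_parts :: "nat \<Rightarrow> nat \<Rightarrow> side \<Rightarrow> nat" where
  "num_parts m n Left_Side = m"
| "num_parts m n Right_Side = m"
| "num_parts m n Bottom_Side = n"
| "num_parts m n Top_Side = n"

fun side_point :: "nat \<Rightarrow> nat \<Rightarrow> side \<Rightarrow> real \<Rightarrow> real \<times> real" where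
  "side_point m n Left_Side t = (0, t)"
| "side_point m n Right_Side t = (real n, t)"
| "side_point m n Bottom_Side t = (t, 0)"
| "side_point m n Top_Side t = (t, real m)"

text \<open>
  \<open>\<delta> s i\<close> is the displacement, along side \<open>s\<close>, of the \<open>i\<close>-th node of that side; the
  unperturbed graph \<open>BC(m,n)\<close> is the case \<open>\<delta> = (\<lambda>_ _. 0)\<close>. The indices \<open>0\<close> and
  \<open>num_parts m n s\<close> are the vertices of the rectangle, each of which occurs on two sides.
\<close>

definition boundary_nodes :: "nat \<Rightarrow> nat \<Rightarrow> (side \<Rightarrow> nat \<Rightarrow> real) \<Rightarrow> (real \<times> real) set" where
  "boundary_nodes m n \<delta> =
     {side_point m n s (real i + \<delta> s i) | s i. i \<le> num_parts m n s}"

definition chords :: "nat \<Rightarrow> nat \<Rightarrow> (side \<Rightarrow> nat \<Rightarrow> real) \<Rightarrow> (real \<times> real) set set" where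
  "chords m n \<delta> =
     {closed_segment p q | p q. p \<in> boundary_nodes m n \<delta> \<and> q \<in> boundary_nodes m n \<delta> \<and> p \<noteq> q}"

definition interior_nodes :: "nat \<Rightarrow> nat \<Rightarrow> (side \<Rightarrow> nat \<Rightarrow> real) \<Rightarrow> (real \<times> real) set" where
  "interior_nodes m n \<delta> =
     {x \<in> interior (rectangle m n).
        \<exists>c\<in>chords m n \<delta>. \<exists>d\<in>chords m n \<delta>. c \<noteq> d \<and> x \<in> c \<and> x \<in> d}"

text \<open>
  The vertices are fixed and the order along each side is kept; as the vertices are the first
  and the last node of their sides, this also keeps all other nodes in the interior of their
  sides.
\<close>

definition admissible_displacement :: "nat \<Rightarrow> nat \<Rightarrow> (side \<Rightarrow> nat \<Rightarrow> real) \<Rightarrow> bool" where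
  "admissible_displacement m n \<delta> \<longleftrightarrow>
     (\<forall>s. \<delta> s 0 = 0 \<and> \<delta> s (num_parts m n s) = 0 \<and>
          strict_mono_on {0..num_parts m n s} (\<lambda>i. real i + \<delta> s i))"

definition general_position :: "nat \<Rightarrow> nat \<Rightarrow> (side \<Rightarrow> nat \<Rightarrow> real) \<Rightarrow> bool" where
  "general_position m n \<delta> \<longleftrightarrow>
     admissible_displacement m n \<delta> \<and>
     \<not> (\<exists>x \<in> interior (rectangle m n). card {c \<in> chords m n \<delta>. x \<in> c} \<ge> 3)"

end

theory Submission
  imports Defs
begin

text \<open>
  A node is the crossing of two chords, and in general position it determines their four endpoints.
  Conversely, let \<open>S\<close> be a set of four boundary nodes. If three of them lie on one closed side, then
  one of the chords of any pair of disjoint chords on \<open>S\<close> runs along that side, so \<open>S\<close> gives no node.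
  Otherwise, in a Radon partition of \<open>S\<close> the two convex hulls meet at an interior point of the
  rectangle, because the sides are faces; so the partition consists of two pairs, i.e. of two crossing
  chords. No other pairing of \<open>S\<close> yields crossing chords, because eliminating one of the
  endpoints would put a point of \<open>S\<close> between two others. Hence the number of nodes is the number of
  4-subsets of the \<open>2 (m + n)\<close> boundary nodes with at most two elements on each closed side.
\<close>

subsection \<open>Crossing chords of a convex set\<close>

text \<open>Eliminating \<open>a\<close> leaves an affine relation among \<open>b\<close>,
  \<open>c\<close>, \<open>d\<close> with coefficients \<open>\<beta>\<close>,
  \<open>\<kappa>\<close>, \<open>\<gamma>\<close>, where \<open>\<beta>\<close> and
  \<open>\<gamma>\<close> are nonnegative. The sign of \<open>\<kappa>\<close> decides which point
  lies between the other two: \<open>b\<close> between \<open>c\<close> and \<open>d\<close>, or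
  \<open>c\<close> between \<open>b\<close> and \<open>d\<close>.\<close>

lemma distinct_segments_disjoint:
  fixes a b c d :: "'a::real_vector"
  assumes "x \<in> closed_segment a b" "x \<in> closed_segment c d"
    and "y \<in> closed_segment a c" "y \<in> closed_segment b d"
    and a: "a \<notin> closed_segment c d" and b: "b \<notin> closed_segment c d"
    and c: "c \<notin> closed_segment b d"
  shows False
proof -
  obtain u where u: "0 \<le> u" "u \<le> 1" "x = (1 - u) *\<^sub>R a + u *\<^sub>R b"
    using assms(1) by (auto simp: in_segment)
  obtain v where v: "0 \<le> v" "v \<le> 1" "x = (1 - v) *\<^sub>R c + v *\<^sub>R d"
    using assms(2) by (auto simp: in_segment)
  obtain p where p: "0 \<le> p" "p \<le> 1" "y = (1 - p) *\<^sub>R a + p *\<^sub>R c"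
    using assms(3) by (auto simp: in_segment)
  obtain q where q: "0 \<le> q" "q \<le> 1" "y = (1 - q) *\<^sub>R b + q *\<^sub>R d"
    using assms(4) by (auto simp: in_segment)
  define \<beta> where "\<beta> = (1 - u) * (1 - q) + (1 - p) * u"
  define \<gamma> where "\<gamma> = (1 - p) * (1 - v) + (1 - u) * p"
  define \<kappa> where "\<kappa> = (1 - u) * q - (1 - p) * v"
  have nonneg: "0 \<le> \<beta>" "0 \<le> \<gamma>"
    using u v p q by (auto simp: \<beta>_def \<gamma>_def)
  have sum: "\<beta> + \<kappa> = \<gamma>"
    by (simp add: \<beta>_def \<gamma>_def \<kappa>_def algebra_simps)
  \<comment> \<open>Eliminating \<open>a\<close> between the two expressions for \<open>x\<close> and \<open>y\<close>.\<close>
  have "(1 - p) *\<^sub>R ((1 - u) *\<^sub>R a + u *\<^sub>R b) - (1 - u) *\<^sub>R ((1 - p) *\<^sub>R a + p *\<^sub>R c)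
      = (1 - p) *\<^sub>R ((1 - v) *\<^sub>R c + v *\<^sub>R d) - (1 - u) *\<^sub>R ((1 - q) *\<^sub>R b + q *\<^sub>R d)"
    using u(3) v(3) p(3) q(3) by simp
  then have rel: "\<beta> *\<^sub>R b + \<kappa> *\<^sub>R d = \<gamma> *\<^sub>R c"
    unfolding \<beta>_def \<gamma>_def \<kappa>_def
    by (simp add: algebra_simps)
  consider "\<kappa> < 0" | "0 \<le> \<kappa>" "0 < \<gamma>" | "0 \<le> \<kappa>" "\<gamma> = 0"
    using nonneg by linarith
  then show False
  proof cases
    case 1
    then have "0 < \<beta>" using sum nonneg by linarith
    have "\<beta> *\<^sub>R b = \<gamma> *\<^sub>R c + (- \<kappa>) *\<^sub>R d"
      using rel by (simp add: algebra_simps)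
    then have "b = (1 / \<beta>) *\<^sub>R (\<gamma> *\<^sub>R c + (- \<kappa>) *\<^sub>R d)"
      using \<open>0 < \<beta>\<close> by (simp only: \<open>\<beta> *\<^sub>R b = _\<close>[symmetric]) simp
    also have "\<dots> = (1 - (- \<kappa> / \<beta>)) *\<^sub>R c + (- \<kappa> / \<beta>) *\<^sub>R d"
    proof -
      have "1 - (- \<kappa> / \<beta>) = \<gamma> / \<beta>" using sum \<open>0 < \<beta>\<close> by (simp add: field_simps)
      then show ?thesis by (simp add: scaleR_diff_right)
    qed
    finally have "b \<in> closed_segment c d"
      using 1 \<open>0 < \<beta>\<close> sum nonneg unfolding in_segment
      by (intro exI[of _ "- \<kappa> / \<beta>"]) (auto simp: field_simps)
    then show False using b by simp
  next
    case 2
    have "c = (1 / \<gamma>) *\<^sub>R (\<beta> *\<^sub>R b + \<kappa> *\<^sub>R d)"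
      using 2 by (simp add: rel)
    also have "\<dots> = (1 - (\<kappa> / \<gamma>)) *\<^sub>R b + (\<kappa> / \<gamma>) *\<^sub>R d"
    proof -
      have "1 - \<kappa> / \<gamma> = \<beta> / \<gamma>" using sum 2 by (simp add: field_simps)
      then show ?thesis by (simp add: scaleR_add_right)
    qed
    finally have "c \<in> closed_segment b d"
      using 2 sum nonneg unfolding in_segment
      by (intro exI[of _ "\<kappa> / \<gamma>"]) (auto simp: field_simps)
    then show False using c by simp
  next
    case 3
    then have "\<beta> = 0" using sum nonneg by linarith
    \<comment> \<open>All three coefficients vanish, so the relation says nothing. The vanishing
      products instead force \<open>u\<close> to be 0 or 1, so that \<open>x\<close> is
      \<open>a\<close> or \<open>b\<close>.\<close>
    have z: "(1 - u) * p = 0" "(1 - p) * u = 0"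
      using \<open>\<beta> = 0\<close> \<open>\<gamma> = 0\<close> u v p q unfolding \<beta>_def \<gamma>_def
      by (smt (verit) mult_nonneg_nonneg)+
    show False
    proof (cases "u = 1")
      case True
      then show False using u(3) assms(2) b by simp
    next
      case False
      then have "u = 0" using z by auto
      then show False using u(3) assms(2) a by simp
    qed
  qed
qed

text \<open>The ray from \<open>x\<close> through \<open>y\<close> stays on the line of the segment
  and reaches \<open>b\<close> if \<open>y\<close> lies further from \<open>a\<close> than
  \<open>x\<close> does, and \<open>a\<close> otherwise.\<close>

lemma segment_extend_to_endpoint:
  fixes a b x y :: "'a::real_vector"
  assumes "x \<in> closed_segment a b" "y \<in> closed_segment a b" "x \<noteq> y" "x \<noteq> a" "x \<noteq> b"
  obtains s p where "0 < s" "p \<in> {a, b}" "p = x + s *\<^sub>R (y - x)"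
proof -
  obtain u where u: "0 \<le> u" "u \<le> 1" "x = (1 - u) *\<^sub>R a + u *\<^sub>R b"
    using assms(1) by (auto simp: in_segment)
  obtain v where v: "0 \<le> v" "v \<le> 1" "y = (1 - v) *\<^sub>R a + v *\<^sub>R b"
    using assms(2) by (auto simp: in_segment)
  have "u \<noteq> 0" "u \<noteq> 1" "u \<noteq> v" using assms u v by auto
  have yx: "y - x = (v - u) *\<^sub>R (b - a)" unfolding u(3) v(3) by (simp add: algebra_simps)
  have xa: "x = a + u *\<^sub>R (b - a)" using u by (simp add: algebra_simps)
  show thesis
  proof (cases "u < v")
    case True
    have "b = x + ((1 - u) / (v - u)) *\<^sub>R (y - x)"
    proof -
      have "((1 - u) / (v - u)) *\<^sub>R (y - x) = (1 - u) *\<^sub>R (b - a)"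
        using True by (simp add: yx)
      then show ?thesis by (simp add: xa algebra_simps)
    qed
    moreover have "0 < (1 - u) / (v - u)" using True \<open>u \<noteq> 1\<close> u by simp
    ultimately show ?thesis using that by blast
  next
    case False
    have "a = x + (u / (u - v)) *\<^sub>R (y - x)"
    proof -
      have "(u / (u - v)) *\<^sub>R (y - x) = (u / (u - v) * (v - u)) *\<^sub>R (b - a)"
        by (simp add: yx)
      also have "u / (u - v) * (v - u) = - u"
        using \<open>u \<noteq> v\<close> by (simp add: field_simps)
      finally show ?thesis by (simp add: xa)
    qed
    moreover have "0 < u / (u - v)" using False \<open>u \<noteq> v\<close> \<open>u \<noteq> 0\<close> u by simp
    ultimately show ?thesis using that by blast
  qed
qed

text \<open>Of two such points on the ray, the nearer one would lie strictly between the interior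
  point \<open>x\<close> and a point of \<open>K\<close>, hence in the interior.\<close>

lemma ray_exit_unique:
  fixes K :: "'a::euclidean_space set"
  assumes "convex K" "x \<in> interior K" "0 < s" "0 < t"
    and "x + s *\<^sub>R v \<in> K - interior K" "x + t *\<^sub>R v \<in> K - interior K"
  shows "x + s *\<^sub>R v = x + t *\<^sub>R v"
proof -
  have aux: "\<not> s < t" if "0 < s" "x + s *\<^sub>R v \<in> K - interior K" "x + t *\<^sub>R v \<in> K - interior K" for s t
  proof
    assume "s < t"
    have "x \<noteq> x + t *\<^sub>R v" using assms(2) that(3) by auto
    moreover have "x + s *\<^sub>R v = (1 - s / t) *\<^sub>R x + (s / t) *\<^sub>R (x + t *\<^sub>R v)"
      using \<open>s < t\<close> that(1) by (simp add: algebra_simps)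
    ultimately have "x + s *\<^sub>R v \<in> open_segment x (x + t *\<^sub>R v)"
      using \<open>s < t\<close> that(1) unfolding in_segment
      by (intro conjI exI[of _ "s / t"]) (auto simp: field_simps)
    then have "x + s *\<^sub>R v \<in> interior K"
      using in_interior_closure_convex_segment[OF assms(1,2), of "x + t *\<^sub>R v"] that(3) closure_subset
      by blast
    with that(2) show False by simp
  qed
  show ?thesis
    using aux[of s t] aux[of t s] assms by (metis linorder_neqE)
qed

text \<open>The pairing is hidden under the existential quantifier because nodes are counted by
  their sets of four endpoints; that the pairing is forced is part of
  \<open>crossing_unique\<close>.\<close>

definition crosses_at :: "'a::real_vector set \<Rightarrow> 'a \<Rightarrow> bool" where
  "crosses_at S x \<longleftrightarrow> (\<exists>a b c d. S = {a, b, c, d} \<and> distinct [a, b, c, d] \<and>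
     x \<in> closed_segment a b \<and> x \<in> closed_segment c d)"

lemma crosses_atE:
  assumes "crosses_at S x"
  obtains a b c d where "S = {a, b, c, d}" "distinct [a, b, c, d]"
    "x \<in> closed_segment a b" "x \<in> closed_segment c d"
  using assms unfolding crosses_at_def by blast

text \<open>Isolates what the crossing arguments use of the rectangle: convexity, and a boundary
  covered by faces. The faces may overlap, as closed sides do at a vertex.\<close>

locale polygon_sides =
  fixes K :: "'a::euclidean_space set" and F :: "'i \<Rightarrow> 'a set"
  assumes convex: "convex K"
    and face: "F i face_of K"
    and boundary: "K - interior K = (\<Union>i. F i)"
begin

text \<open>A face of \<open>K\<close> cuts \<open>convex hull T\<close> in a face of that hull, and
  a face of the hull of a finite set is the hull of some of its points.\<close>

lemma side_Int_hull:
  assumes "finite T" "T \<subseteq> K" "x \<in> F i" "x \<in> convex hull T"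
  shows "x \<in> convex hull (T \<inter> F i)"
proof -
  have "convex hull T \<subseteq> K" using assms(2) convex by (simp add: hull_minimal)
  then have "(F i \<inter> convex hull T) face_of (convex hull T)"
    using face_of_slice[OF face, of "convex hull T" i] by (simp add: Int_absorb1)
  then obtain T' where T': "T' \<subseteq> T" "F i \<inter> convex hull T = convex hull T'"
    using face_of_convex_hull_subset[of T] assms(1) finite_imp_compact by metis
  then have "T' \<subseteq> T \<inter> F i" using hull_subset[of T' convex] by blast
  then show ?thesis using T' assms(3,4) hull_mono by blast
qed

text \<open>A face containing a point strictly between \<open>a\<close> and \<open>b\<close>
  contains both, so the side through \<open>c\<close> would hold three points of
  \<open>S\<close>.\<close>

lemma few_on_side_imp_not_in_segment:
  assumes S: "S \<subseteq> K - interior K" "finite S" "\<And>i. card (S \<inter> F i) \<le> 2"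
    and "a \<in> S" "b \<in> S" "c \<in> S" "c \<noteq> a" "c \<noteq> b" "a \<noteq> b"
  shows "c \<notin> closed_segment a b"
proof
  assume "c \<in> closed_segment a b"
  then have "c \<in> open_segment a b" using assms by (simp add: open_segment_def)
  moreover obtain i where i: "c \<in> F i" using boundary assms by blast
  ultimately have "a \<in> F i" "b \<in> F i" using face_ofD[OF face] assms by blast+
  then have "{a, b, c} \<subseteq> S \<inter> F i" using i assms by simp
  then have "card {a, b, c} \<le> card (S \<inter> F i)" using assms by (intro card_mono) auto
  with S(3)[of i] assms(7-9) show False by (simp add: card_insert_if)
qed

text \<open>Radon's theorem supplies the pairing, so no cyclic order of the boundary points is
  needed.\<close>

lemma crossing_exists:
  assumes dim: "DIM('a) = 2"
    and S: "S \<subseteq> K - interior K" "card S = 4" "\<And>i. card (S \<inter> F i) \<le> 2"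
  shows "\<exists>x\<in>interior K. crosses_at S x"
proof -
  have fin: "finite S" using S(2) card.infinite by fastforce
  \<comment> \<open>Four is exactly \<open>DIM('a) + 2\<close>, the size from which affine
    dependence is automatic.\<close>
  have "affine_dependent S" using affine_dependent_biggerset[OF fin] dim S(2) by simp
  then obtain M P x where MP: "M \<inter> P = {}" "M \<union> P = S"
    and x: "x \<in> convex hull M" "x \<in> convex hull P"
    using Radon_partition[OF fin] by blast
  have finMP: "finite M" "finite P" and MPK: "M \<subseteq> K" "P \<subseteq> K" using fin MP S(1) by auto
  \<comment> \<open>On a side, each part contributes at least one point, hence exactly one by the
    bound 2. Both hulls then shrink to the same point, although the parts are disjoint.\<close>
  have not_side: "x \<notin> F i" for i
  proof
    assume "x \<in> F i"
    then have xM: "x \<in> convex hull (M \<inter> F i)" and xP: "x \<in> convex hull (P \<inter> F i)"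
      using x finMP MPK by (auto intro: side_Int_hull)
    have "M \<inter> F i \<noteq> {}" "P \<inter> F i \<noteq> {}" using xM xP by force+
    then have "0 < card (M \<inter> F i)" "0 < card (P \<inter> F i)" using finMP by (auto simp: card_gt_0_iff)
    moreover have "card (M \<inter> F i) + card (P \<inter> F i) = card (S \<inter> F i)"
      using MP finMP by (subst card_Un_disjoint[symmetric]) (auto intro!: arg_cong[of _ _ card])
    ultimately have "card (M \<inter> F i) = 1" "card (P \<inter> F i) = 1" using S(3)[of i] by linarith+
    then obtain y z where "M \<inter> F i = {y}" "P \<inter> F i = {z}" by (auto simp: card_1_singleton_iff)
    with xM xP have "y = z" by simp
    with MP(1) \<open>M \<inter> F i = {y}\<close> \<open>P \<inter> F i = {z}\<close> show False by blast
  qed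
  moreover have "x \<in> K" using x(1) MPK convex by (meson hull_minimal subsetD)
  ultimately have xint: "x \<in> interior K" using boundary by blast
  \<comment> \<open>A part with a single element would make the Radon point a boundary point. This
    excludes the splits 1+3 and 0+4.\<close>
  have big: "2 \<le> card T" if T: "T \<subseteq> S" "x \<in> convex hull T" for T
  proof (rule ccontr)
    assume "\<not> 2 \<le> card T"
    then have "card T = 0 \<or> card T = 1" by linarith
    moreover have "finite T" using T fin finite_subset by blast
    ultimately have "T = {} \<or> (\<exists>y. T = {y})" by (auto simp: card_1_singleton_iff)
    then obtain y where "T = {y}" using T(2) by auto
    then have "x \<in> S" using T by simp
    then show False using xint S(1) by blast
  qed
  have "card M + card P = 4"
    using MP finMP S(2) card_Un_disjoint by metis
  moreover have "2 \<le> card M" "2 \<le> card P" using big MP x by auto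
  ultimately have "card M = 2" "card P = 2" by linarith+
  then obtain a b c d where ab: "M = {a, b}" "a \<noteq> b" and cd: "P = {c, d}" "c \<noteq> d"
    by (auto simp: card_2_iff)
  have "S = {a, b, c, d}" using MP(2) ab(1) cd(1) by blast
  moreover have "distinct [a, b, c, d]" using MP(1) ab cd by auto
  moreover have "x \<in> closed_segment a b" "x \<in> closed_segment c d"
    using x ab(1) cd(1) by (simp_all add: segment_convex_hull)
  ultimately have "crosses_at S x" unfolding crosses_at_def by blast
  with xint show ?thesis by blast
qed

text \<open>Two common points would span a ray from \<open>x\<close> that leaves \<open>K\<close> at
  an endpoint of each chord; as the exit is unique, the chords would share that endpoint.\<close>

lemma two_chords_meet_once:
  assumes xy: "x \<in> interior K" "x \<in> closed_segment a b" "x \<in> closed_segment c d"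
      "y \<in> closed_segment a b" "y \<in> closed_segment c d"
    and bd: "{a, b, c, d} \<subseteq> K - interior K"
    and "distinct [a, b, c, d]"
  shows "x = y"
proof (rule ccontr)
  assume "x \<noteq> y"
  have ne: "x \<noteq> a" "x \<noteq> b" "x \<noteq> c" "x \<noteq> d" using xy(1) bd by auto
  obtain s p where p: "0 < s" "p \<in> {a, b}" "p = x + s *\<^sub>R (y - x)"
    using segment_extend_to_endpoint[OF xy(2,4) \<open>x \<noteq> y\<close> ne(1,2)] .
  obtain t q where q: "0 < t" "q \<in> {c, d}" "q = x + t *\<^sub>R (y - x)"
    using segment_extend_to_endpoint[OF xy(3,5) \<open>x \<noteq> y\<close> ne(3,4)] .
  have "p = q"
    using ray_exit_unique[OF convex xy(1) p(1) q(1), of "y - x"] p q bd by blast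
  with p(2) q(2) assms(7) show False by auto
qed

text \<open>Both \<open>b\<close> and \<open>c\<close> are the point where the ray from
  \<open>x\<close> directed away from \<open>a\<close> leaves \<open>K\<close>.\<close>

lemma chord_determined_by_endpoint:
  assumes "x \<in> interior K" "x \<in> closed_segment a b" "x \<in> closed_segment a c"
    and bd: "{a, b, c} \<subseteq> K - interior K"
  shows "b = c"
proof -
  have ne: "x \<noteq> a" "x \<noteq> b" "x \<noteq> c" using assms(1) bd by auto
  have *: "\<exists>t>0. b = x + t *\<^sub>R (x - a)" if b: "x \<in> closed_segment a b" "x \<noteq> a" "x \<noteq> b" for b
  proof -
    obtain u where u: "0 \<le> u" "u \<le> 1" "x = (1 - u) *\<^sub>R a + u *\<^sub>R b"
      using b(1) by (auto simp: in_segment)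
    then have "u \<noteq> 0" "u \<noteq> 1" using b by auto
    have "x - a = u *\<^sub>R (b - a)" "x = b - (1 - u) *\<^sub>R (b - a)"
      using u(3) by (simp_all add: algebra_simps)
    then have "b = x + ((1 - u) / u) *\<^sub>R (x - a)" using \<open>u \<noteq> 0\<close> by simp
    moreover have "0 < (1 - u) / u" using u \<open>u \<noteq> 0\<close> \<open>u \<noteq> 1\<close> by simp
    ultimately show ?thesis by blast
  qed
  obtain s t where "0 < s" "b = x + s *\<^sub>R (x - a)" "0 < t" "c = x + t *\<^sub>R (x - a)"
    using *[OF assms(2) ne(1,2)] *[OF assms(3) ne(1,3)] by blast
  then show ?thesis
    using ray_exit_unique[OF convex assms(1), of s t "x - a"] bd by blast
qed

text \<open>If both points use the same pairing of \<open>S\<close>,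
  \<open>two_chords_meet_once\<close> applies; different pairings contradict
  \<open>distinct_segments_disjoint\<close>.\<close>

lemma crossing_unique:
  assumes S: "S \<subseteq> K - interior K" "finite S" "\<And>i. card (S \<inter> F i) \<le> 2"
    and x: "x \<in> interior K" "crosses_at S x" and y: "crosses_at S y"
  shows "x = y"
proof -
  obtain a b c d where S1: "S = {a, b, c, d}" "distinct [a, b, c, d]"
    and x': "x \<in> closed_segment a b" "x \<in> closed_segment c d"
    using x(2) by (rule crosses_atE)
  note no_seg = few_on_side_imp_not_in_segment[OF S]
  obtain a' b' c' d' where S2: "S = {a', b', c', d'}" "distinct [a', b', c', d']"
    and y': "y \<in> closed_segment a' b'" "y \<in> closed_segment c' d'"
    using y by (rule crosses_atE)
  \<comment> \<open>The pairing at \<open>y\<close> is relabelled to start with \<open>a\<close>.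
    Only the partner \<open>e\<close> of \<open>a\<close> then distinguishes the three possible
    pairings.\<close>
  have "\<exists>e f g. {a, e, f, g} = S \<and> distinct [a, e, f, g] \<and>
      y \<in> closed_segment a e \<and> y \<in> closed_segment f g"
  proof -
    consider "a = a'" | "a = b'" | "a = c'" | "a = d'" using S1(1) S2(1) by blast
    then show ?thesis
    proof cases
      case 1
      then show ?thesis using S2(2) y' by (intro exI[of _ b'] exI[of _ c'] exI[of _ d']) (auto simp: S2(1))
    next
      case 2
      then show ?thesis using S2(2) y'
        by (intro exI[of _ a'] exI[of _ c'] exI[of _ d']) (auto simp: S2(1) closed_segment_commute)
    next
      case 3
      then show ?thesis using S2(2) y' by (intro exI[of _ d'] exI[of _ a'] exI[of _ b']) (auto simp: S2(1))
    next
      case 4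
      then show ?thesis using S2(2) y'
        by (intro exI[of _ c'] exI[of _ a'] exI[of _ b']) (auto simp: S2(1) closed_segment_commute)
    qed
  qed
  then obtain e f g where afg: "{a, e, f, g} = {a, b, c, d}" "distinct [a, e, f, g]"
      and y2: "y \<in> closed_segment a e" "y \<in> closed_segment f g"
    unfolding S1(1) by blast
  have "{e, f, g} = {a, e, f, g} - {a}" using afg(2) by auto
  also have "\<dots> = {b, c, d}" unfolding afg(1) using S1(2) by auto
  finally have rest: "{e, f, g} = {b, c, d}" .
  have "{f, g} = {e, f, g} - {e}" using afg(2) by auto
  then have fg: "y \<in> closed_segment f' g'" if "{b, c, d} - {e} = {f', g'}" for f' g'
  proof -
    have "{f, g} = {f', g'}" using \<open>{f, g} = _\<close> rest that by simp
    then consider "f = f'" "g = g'" | "f = g'" "g = f'" by (auto simp: doubleton_eq_iff)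
    then show ?thesis using y2(2) by cases (simp_all add: closed_segment_commute)
  qed
  have inS: "a \<in> S" "b \<in> S" "c \<in> S" "d \<in> S" using S1 by auto
  consider "e = b" | "e = c" | "e = d" using rest by blast
  then show ?thesis
  proof cases
    case 1
    have "{b, c, d} - {e} = {c, d}" using 1 S1(2) by auto
    then have y3: "y \<in> closed_segment a b" "y \<in> closed_segment c d"
      using y2(1) 1 fg by blast+
    then show ?thesis
      using two_chords_meet_once[OF x(1) x' y3] S1 S(1) by simp
  next
    case 2
    have "{b, c, d} - {e} = {b, d}" using 2 S1(2) by auto
    then have y3: "y \<in> closed_segment a c" "y \<in> closed_segment b d"
      using y2(1) 2 fg by blast+
    from distinct_segments_disjoint[OF x' y3] show ?thesis
      using no_seg[OF inS(3,4,1)] no_seg[OF inS(3,4,2)] no_seg[OF inS(2,4,3)] S1(2) by auto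
  next
    case 3
    have "{b, c, d} - {e} = {b, c}" using 3 S1(2) by auto
    then have y3: "y \<in> closed_segment a d" "y \<in> closed_segment b c"
      using y2(1) 3 fg by blast+
    \<comment> \<open>Exchanging \<open>c\<close> and \<open>d\<close> turns this case into the
      previous one.\<close>
    have "x \<in> closed_segment d c" using x'(2) by (simp add: closed_segment_commute)
    from distinct_segments_disjoint[OF x'(1) this y3] show ?thesis
      using no_seg[OF inS(4,3,1)] no_seg[OF inS(4,3,2)] no_seg[OF inS(2,3,4)] S1(2) by auto
  qed
qed

text \<open>A convex side that misses \<open>x\<close> cannot contain both endpoints of a chord
  through \<open>x\<close>, so each of the two disjoint pairs has a point off the side.\<close>

lemma crossing_few_on_side:
  assumes "crosses_at S x" "x \<in> interior K"
  shows "card (S \<inter> F i) \<le> 2"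
proof (rule ccontr)
  assume "\<not> ?thesis"
  then have three: "3 \<le> card (S \<inter> F i)" by linarith
  obtain a b c d where S: "S = {a, b, c, d}" "distinct [a, b, c, d]"
    and x: "x \<in> closed_segment a b" "x \<in> closed_segment c d"
    using assms(1) by (rule crosses_atE)
  have cvx: "convex (F i)" using face face_of_imp_convex by blast
  have "x \<notin> F i" using boundary assms(2) by blast
  then have ab: "\<not> {a, b} \<subseteq> F i" and cd: "\<not> {c, d} \<subseteq> F i"
    using x cvx by (auto dest: convex_contains_segment[THEN iffD1])
  obtain p where p: "p \<in> {a, b}" "p \<notin> F i" using ab by auto
  obtain q where q: "q \<in> {c, d}" "q \<notin> F i" using cd by auto
  have "S \<inter> F i \<subseteq> S - {p, q}" using p q by blast
  then have "card (S \<inter> F i) \<le> card (S - {p, q})" using S by (intro card_mono) auto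
  also have "\<dots> = 2" using S p q by (subst card_Diff_subset) auto
  finally show False using three by simp
qed

text \<open>The bijection sends a 4-set to its crossing point. General position gives injectivity;
  surjectivity rests on \<open>crossing_few_on_side\<close> and
  \<open>crossing_unique\<close>.\<close>

lemma card_crossing_points:
  fixes B :: "'a set"
  defines "C \<equiv> {closed_segment p q | p q. p \<in> B \<and> q \<in> B \<and> p \<noteq> q}"
  assumes dim: "DIM('a) = 2" and B: "finite B" "B \<subseteq> K - interior K"
    and gp: "\<And>x. x \<in> interior K \<Longrightarrow> card {c \<in> C. x \<in> c} < 3"
  shows "card {x \<in> interior K. \<exists>c\<in>C. \<exists>d\<in>C. c \<noteq> d \<and> x \<in> c \<and> x \<in> d} =
         card {S. S \<subseteq> B \<and> card S = 4 \<and> (\<forall>i. card (S \<inter> F i) \<le> 2)}"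
    (is "card ?X = card ?G")
proof -
  have finC: "finite C"
  proof (rule finite_subset)
    show "C \<subseteq> (\<lambda>(p, q). closed_segment p q) ` (B \<times> B)" unfolding C_def by auto
  qed (use B in auto)
  have card4: "card {a, b, c, d} = 4" if "distinct [a, b, c, d]" for a b c d :: 'a
    using that by auto
  have ex: "\<exists>x. x \<in> interior K \<and> crosses_at S x" if "S \<in> ?G" for S
    using crossing_exists[OF dim, of S] that B by blast
  define f where "f S = (SOME x. x \<in> interior K \<and> crosses_at S x)" for S
  have f: "f S \<in> interior K" "crosses_at S (f S)" if "S \<in> ?G" for S
    using someI_ex[OF ex[OF that]] unfolding f_def by blast+
  \<comment> \<open>By general position, the chords through \<open>x\<close>, and hence their endpoints, are determined by \<open>x\<close>.\<close>
  have det: "S = T" if cross: "crosses_at S x" "crosses_at T x"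
    and sub: "x \<in> interior K" "S \<subseteq> B" "T \<subseteq> B" for S T x
  proof (rule ccontr)
    assume "S \<noteq> T"
    obtain a b c d where S: "S = {a, b, c, d}" "distinct [a, b, c, d]"
      and xS: "x \<in> closed_segment a b" "x \<in> closed_segment c d"
      using cross(1) by (rule crosses_atE)
    obtain a' b' c' d' where T: "T = {a', b', c', d'}" "distinct [a', b', c', d']"
      and xT: "x \<in> closed_segment a' b'" "x \<in> closed_segment c' d'"
      using cross(2) by (rule crosses_atE)
    let ?D = "{closed_segment a b, closed_segment c d, closed_segment a' b', closed_segment c' d'}"
    have C: "closed_segment p q \<in> C" if "p \<in> B" "q \<in> B" "p \<noteq> q" for p q
      using that unfolding C_def by blast
    have "?D \<subseteq> {c \<in> C. x \<in> c}" using S T xS xT sub(2,3) by (auto intro!: C)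
    then have "card ?D \<le> card {c \<in> C. x \<in> c}" using finC by (intro card_mono) auto
    also have "\<dots> < 3" using gp sub(1) by blast
    finally have "card ?D < 3" .
    then have D: "card ({{a, b}, {c, d}, {a', b'}, {c', d'}}) < 3"
    proof -
      \<comment> \<open>A segment determines its pair of endpoints, so the bound on chords through
        \<open>x\<close> becomes a bound on pairs.\<close>
      have "inj_on (\<lambda>Q. convex hull Q) {{a, b}, {c, d}, {a', b'}, {c', d'}}"
        by (auto simp: inj_on_def closed_segment_eq simp flip: segment_convex_hull)
      from card_image[OF this] show ?thesis
        using \<open>card ?D < 3\<close> by (simp add: segment_convex_hull)
    qed
    have "{a, b} \<noteq> {c, d}" using S by auto
    have "{a', b'} \<in> {{a, b}, {c, d}}" "{c', d'} \<in> {{a, b}, {c, d}}"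
    proof -
      \<comment> \<open>Two distinct pairs already exhaust a set with fewer than three elements, so
        the pairs of \<open>T\<close> occur among those of \<open>S\<close>.\<close>
      have eq: "{{a, b}, {c, d}} = {{a, b}, {c, d}, {a', b'}, {c', d'}}"
        by (rule card_seteq) (use D \<open>{a, b} \<noteq> {c, d}\<close> in auto)
      show "{a', b'} \<in> {{a, b}, {c, d}}" "{c', d'} \<in> {{a, b}, {c, d}}"
        by (subst eq, blast)+
    qed
    then have "T \<subseteq> S" using S T by blast
    moreover have "card S = card T" using card4 S T by simp
    ultimately have "S = T" using S card_subset_eq[of S T] by simp
    with \<open>S \<noteq> T\<close> show False by simp
  qed
  have "bij_betw f ?G ?X"
  proof (rule bij_betwI')
    fix S T assume "S \<in> ?G" "T \<in> ?G"
    then show "(f S = f T) = (S = T)" using det[of S "f S" T] f by auto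
  next
    fix S assume S: "S \<in> ?G"
    obtain a b c d where abcd: "S = {a, b, c, d}" "distinct [a, b, c, d]"
      "f S \<in> closed_segment a b" "f S \<in> closed_segment c d"
      using f(2)[OF S] by (rule crosses_atE)
    then have "closed_segment a b \<noteq> closed_segment c d"
      by (simp add: closed_segment_eq doubleton_eq_iff)
    moreover have "closed_segment a b \<in> C" "closed_segment c d \<in> C"
      using abcd S unfolding C_def by auto
    ultimately show "f S \<in> ?X" using f[OF S] abcd by blast
  next
    fix x assume "x \<in> ?X"
    then obtain k l where kl: "x \<in> interior K" "k \<in> C" "l \<in> C" "k \<noteq> l" "x \<in> k" "x \<in> l"
      by blast
    obtain a b where ab: "k = closed_segment a b" "a \<in> B" "b \<in> B" "a \<noteq> b"
      using kl(2) unfolding C_def by blast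
    obtain c d where cd: "l = closed_segment c d" "c \<in> B" "d \<in> B" "c \<noteq> d"
      using kl(3) unfolding C_def by blast
    have x: "x \<in> interior K" "x \<in> closed_segment a b" "x \<in> closed_segment c d"
      using kl ab cd by simp_all
    then have x': "x \<in> closed_segment b a" "x \<in> closed_segment d c"
      by (simp_all add: closed_segment_commute)
    have bd: "{a, b, c, d} \<subseteq> K - interior K" using ab cd B by blast
    have "{a, b} \<noteq> {c, d}" using kl(4) by (simp add: ab cd closed_segment_eq)
    \<comment> \<open>With a shared endpoint, the other endpoints would agree too and the two chords
      would coincide.\<close>
    have d: "distinct [a, b, c, d]"
    proof (rule ccontr)
      assume "\<not> distinct [a, b, c, d]"
      then consider "a = c" | "a = d" | "b = c" | "b = d" using ab cd by auto
      then show False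
      proof cases
        case 1
        then show False
          using chord_determined_by_endpoint[OF x(1), of a b d] x bd \<open>{a, b} \<noteq> {c, d}\<close> by simp
      next
        case 2
        then show False
          using chord_determined_by_endpoint[OF x(1), of a b c] x x' bd \<open>{a, b} \<noteq> {c, d}\<close>
          by (simp add: insert_commute)
      next
        case 3
        then show False
          using chord_determined_by_endpoint[OF x(1), of b a d] x x' bd \<open>{a, b} \<noteq> {c, d}\<close>
          by (simp add: insert_commute)
      next
        case 4
        then show False
          using chord_determined_by_endpoint[OF x(1), of b a c] x x' bd \<open>{a, b} \<noteq> {c, d}\<close> by simp
      qed
    qed
    define S where "S = {a, b, c, d}"
    have cr: "crosses_at S x" unfolding crosses_at_def S_def using d x by blast
    have S: "S \<in> ?G"
      using crossing_few_on_side[OF cr x(1)] ab cd card4[OF d] by (simp add: S_def)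
    have "x = f S"
      using crossing_unique[of S x "f S"] S bd x(1) cr f(2)[OF S] S_def by simp
    with S show "\<exists>S\<in>?G. x = f S" by blast
  qed
  then show ?thesis by (rule bij_betw_same_card[symmetric])
qed

end

subsection \<open>Counting 4-subsets\<close>

lemma card_subsets_split:
  assumes "finite A" "finite C" "A \<inter> C = {}"
  shows "card {S. S \<subseteq> A \<union> C \<and> card (S \<inter> A) = i \<and> card (S \<inter> C) = j} =
         (card A choose i) * (card C choose j)"
proof -
  have "bij_betw (\<lambda>S. (S \<inter> A, S \<inter> C)) {S. S \<subseteq> A \<union> C \<and> card (S \<inter> A) = i \<and> card (S \<inter> C) = j}
     ({X. X \<subseteq> A \<and> card X = i} \<times> {Y. Y \<subseteq> C \<and> card Y = j})"
  proof (rule bij_betw_byWitness[where f' = "\<lambda>(X, Y). X \<union> Y"])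
    have aux: "(X \<union> Y) \<inter> A = X" "(X \<union> Y) \<inter> C = Y" if "X \<subseteq> A" "Y \<subseteq> C" for X Y
      using that assms(3) by auto
    show "(\<lambda>(X, Y). X \<union> Y) ` ({X. X \<subseteq> A \<and> card X = i} \<times> {Y. Y \<subseteq> C \<and> card Y = j})
        \<subseteq> {S. S \<subseteq> A \<union> C \<and> card (S \<inter> A) = i \<and> card (S \<inter> C) = j}"
      by (auto simp: aux)
    show "\<forall>a'\<in>{X. X \<subseteq> A \<and> card X = i} \<times> {Y. Y \<subseteq> C \<and> card Y = j}.
        (case case a' of (X, Y) \<Rightarrow> X \<union> Y of S \<Rightarrow> (S \<inter> A, S \<inter> C)) = a'"
      by (auto simp: aux)
  qed auto
  from bij_betw_same_card[OF this] show ?thesis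
    using assms by (simp add: card_cartesian_product n_subsets)
qed

text \<open>Such a set has either three elements in \<open>A\<close> and one outside, or all four in
  \<open>A\<close>.\<close>

lemma card_4_subsets_concentrated:
  assumes "finite B" "A \<subseteq> B"
  shows "card {S. S \<subseteq> B \<and> card S = 4 \<and> 3 \<le> card (S \<inter> A)} =
         (card A choose 3) * (card B - card A) + (card A choose 4)"
proof -
  define part where "part i j = {S. S \<subseteq> A \<union> (B - A) \<and> card (S \<inter> A) = i \<and> card (S \<inter> (B - A)) = j}" for i j
  have AB: "A \<union> (B - A) = B" using assms by blast
  have fin: "finite A" "finite (B - A)" using assms finite_subset by auto
  have card_part: "card (part i j) = (card A choose i) * ((card B - card A) choose j)" for i j
    using card_subsets_split[of A "B - A" i j] fin assms by (simp add: part_def card_Diff_subset)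
  have split: "card S = card (S \<inter> A) + card (S \<inter> (B - A))" if "S \<subseteq> B" for S
    using that fin assms by (subst card_Un_disjoint[symmetric]) (auto intro!: arg_cong[of _ _ card])
  have "{S. S \<subseteq> B \<and> card S = 4 \<and> 3 \<le> card (S \<inter> A)} = part 3 1 \<union> part 4 0"
  proof (rule set_eqI)
    fix S
    show "S \<in> {S. S \<subseteq> B \<and> card S = 4 \<and> 3 \<le> card (S \<inter> A)} \<longleftrightarrow> S \<in> part 3 1 \<union> part 4 0"
      unfolding part_def AB using split[of S] by auto
  qed
  moreover have "part 3 1 \<inter> part 4 0 = {}" by (auto simp: part_def)
  moreover have "finite (part i j)" for i j
    using assms unfolding part_def AB by auto
  ultimately show ?thesis by (simp add: card_Un_disjoint card_part)
qed

text \<open>The 4-sets with three or more points in \<open>F i\<close> form disjoint families for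
  different \<open>i\<close>, so their number is a plain sum. The complement is stated additively to
  avoid a truncated subtraction.\<close>

lemma card_4_subsets_spread:
  fixes F :: "'i \<Rightarrow> 'a set"
  assumes B: "finite B" and I: "finite I"
    and small: "\<And>i j. i \<in> I \<Longrightarrow> j \<in> I \<Longrightarrow> i \<noteq> j \<Longrightarrow> card (B \<inter> F i \<inter> F j) \<le> 1"
  shows "card {S. S \<subseteq> B \<and> card S = 4 \<and> (\<forall>i\<in>I. card (S \<inter> F i) \<le> 2)} +
     (\<Sum>i\<in>I. (card (B \<inter> F i) choose 3) * (card B - card (B \<inter> F i)) + (card (B \<inter> F i) choose 4))
     = card B choose 4"
proof -
  let ?G = "{S. S \<subseteq> B \<and> card S = 4 \<and> (\<forall>i\<in>I. card (S \<inter> F i) \<le> 2)}"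
  define bad where "bad i = {S. S \<subseteq> B \<and> card S = 4 \<and> 3 \<le> card (S \<inter> (B \<inter> F i))}" for i
  have restrict: "S \<inter> (B \<inter> F i) = S \<inter> F i" if "S \<subseteq> B" for S i using that by blast
  have disj: "bad i \<inter> bad j = {}" if "i \<in> I" "j \<in> I" "i \<noteq> j" for i j
  proof (rule ccontr)
    assume "bad i \<inter> bad j \<noteq> {}"
    then obtain S where S: "S \<subseteq> B" "card S = 4" "3 \<le> card (S \<inter> F i)" "3 \<le> card (S \<inter> F j)"
      by (auto simp: bad_def restrict)
    have "finite S" using S B finite_subset by blast
    \<comment> \<open>The left side is at least 6, while the union has at most 4 elements and the
      intersection at most 1.\<close>
    then have "card (S \<inter> F i) + card (S \<inter> F j) =
        card (S \<inter> F i \<union> S \<inter> F j) + card ((S \<inter> F i) \<inter> (S \<inter> F j))"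
      by (intro card_Un_Int) auto
    moreover have "card (S \<inter> F i \<union> S \<inter> F j) \<le> card S"
      using \<open>finite S\<close> by (intro card_mono) auto
    moreover have "card ((S \<inter> F i) \<inter> (S \<inter> F j)) \<le> card (B \<inter> F i \<inter> F j)"
      using B S by (intro card_mono) auto
    ultimately show False using S small[OF that] by linarith
  qed
  have "{S. S \<subseteq> B \<and> card S = 4} = ?G \<union> (\<Union>i\<in>I. bad i)"
    by (auto simp: bad_def restrict not_le)
  then have "card B choose 4 = card (?G \<union> (\<Union>i\<in>I. bad i))"
    using n_subsets[OF B, of 4] by simp
  also have "\<dots> = card ?G + card (\<Union>i\<in>I. bad i)"
  proof (rule card_Un_disjoint)
    show "?G \<inter> (\<Union>i\<in>I. bad i) = {}" by (force simp: bad_def restrict)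
  qed (use B I in \<open>auto simp: bad_def\<close>)
  also have "card (\<Union>i\<in>I. bad i) = (\<Sum>i\<in>I. card (bad i))"
    using disj B I by (intro card_UN_disjoint) (auto simp: bad_def)
  also have "\<dots> = (\<Sum>i\<in>I. (card (B \<inter> F i) choose 3) * (card B - card (B \<inter> F i)) + (card (B \<inter> F i) choose 4))"
    unfolding bad_def using B by (intro sum.cong card_4_subsets_concentrated) auto
  finally show ?thesis by simp
qed

text \<open>Valid for small \<open>k\<close> as well, where the product vanishes.\<close>

lemma real_choose_3: "real (k choose 3) = real k * (real k - 1) * (real k - 2) / 6"
  by (simp add: binomial_gbinomial gbinomial_prod_rev numeral_eq_Suc fact_Suc lessThan_Suc atLeast0LessThan)

lemma real_choose_4: "real (k choose 4) = real k * (real k - 1) * (real k - 2) * (real k - 3) / 24"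
  by (simp add: binomial_gbinomial gbinomial_prod_rev numeral_eq_Suc fact_Suc lessThan_Suc atLeast0LessThan)

subsection \<open>The rectangle and its boundary nodes\<close>

text \<open>Sides are closed: adjacent ones share a vertex, and each carries one node more than it
  has parts.\<close>

definition side_segment :: "nat \<Rightarrow> nat \<Rightarrow> side \<Rightarrow> (real \<times> real) set" where
  "side_segment m n s = side_point m n s ` {0..real (num_parts m n s)}"

lemma UNIV_side: "UNIV = {Left_Side, Right_Side, Bottom_Side, Top_Side}"
  using side.exhaust by auto

lemma rectangle_eq: "rectangle m n = {0..real n} \<times> {0..real m}"
  by (simp add: rectangle_def cbox_Pair_eq)

lemma interior_rectangle: "interior (rectangle m n) = {0<..<real n} \<times> {0<..<real m}"
  by (simp add: rectangle_eq interior_Times)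

text \<open>Each side is the set where a coordinate takes its minimum or maximum on the rectangle,
  i.e. a section by a supporting hyperplane.\<close>

lemma side_segment_face: "side_segment m n s face_of rectangle m n"
proof -
  have cvx: "convex (rectangle m n)" by (simp add: rectangle_def)
  have eqs:
    "side_segment m n Left_Side = rectangle m n \<inter> {x. (1, 0) \<bullet> x = 0}"
    "side_segment m n Right_Side = rectangle m n \<inter> {x. (1, 0) \<bullet> x = real n}"
    "side_segment m n Bottom_Side = rectangle m n \<inter> {x. (0, 1) \<bullet> x = 0}"
    "side_segment m n Top_Side = rectangle m n \<inter> {x. (0, 1) \<bullet> x = real m}"
    by (auto simp: side_segment_def rectangle_eq)
  show ?thesis
    by (cases s; simp only: eqs)
      (rule face_of_Int_supporting_hyperplane_ge face_of_Int_supporting_hyperplane_le,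
        use cvx in \<open>auto simp: rectangle_eq\<close>)+
qed

lemma rectangle_boundary: "rectangle m n - interior (rectangle m n) = (\<Union>s. side_segment m n s)"
  unfolding interior_rectangle UNIV_side by (auto simp: rectangle_eq side_segment_def image_iff)

section \<open>Boundary nodes under an admissible displacement\<close>

context
  fixes m n :: nat and \<delta> :: "side \<Rightarrow> nat \<Rightarrow> real"
  assumes pos: "m \<ge> 1" "n \<ge> 1" and adm: "admissible_displacement m n \<delta>"
begin

definition positions :: "side \<Rightarrow> real set" where
  "positions s = (\<lambda>i. real i + \<delta> s i) ` {0..num_parts m n s}"

lemma positions_props:
  shows positions_finite: "finite (positions s)"
    and positions_card: "card (positions s) = num_parts m n s + 1"
    and positions_0: "0 \<in> positions s"
    and positions_last: "real (num_parts m n s) \<in> positions s"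
    and positions_subset: "positions s \<subseteq> {0..real (num_parts m n s)}"
proof -
  let ?k = "num_parts m n s" and ?f = "\<lambda>i. real i + \<delta> s i"
  have \<delta>: "\<delta> s 0 = 0" "\<delta> s ?k = 0" and mono: "strict_mono_on {0..?k} ?f"
    using adm unfolding admissible_displacement_def by blast+
  show "finite (positions s)" by (simp add: positions_def)
  show "card (positions s) = ?k + 1"
    using strict_mono_on_imp_inj_on[OF mono] by (simp add: positions_def card_image)
  show "0 \<in> positions s"
    using \<delta> unfolding positions_def by (intro image_eqI[of _ _ 0]) auto
  show "real ?k \<in> positions s"
    using \<delta> unfolding positions_def by (intro image_eqI[of _ _ ?k]) auto
  have "?f 0 \<le> ?f i \<and> ?f i \<le> ?f ?k" if "i \<le> ?k" for i
    using strict_mono_on_leD[OF mono, of 0 i] strict_mono_on_leD[OF mono, of i ?k] that by auto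
  then show "positions s \<subseteq> {0..real ?k}" using \<delta> unfolding positions_def by auto
qed

lemma boundary_nodes_eq: "boundary_nodes m n \<delta> = (\<Union>s. side_point m n s ` positions s)"
  unfolding boundary_nodes_def positions_def by fastforce

lemma boundary_nodes_explicit: "boundary_nodes m n \<delta> =
   {0} \<times> positions Left_Side \<union> {real n} \<times> positions Right_Side \<union>
   positions Bottom_Side \<times> {0} \<union> positions Top_Side \<times> {real m}"
  unfolding boundary_nodes_eq UNIV_side by auto

lemma finite_boundary_nodes: "finite (boundary_nodes m n \<delta>)"
  unfolding boundary_nodes_explicit using positions_finite by blast

lemma boundary_nodes_subset: "boundary_nodes m n \<delta> \<subseteq> rectangle m n - interior (rectangle m n)"
  unfolding rectangle_boundary boundary_nodes_eq side_segment_def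
  using positions_subset by fastforce

text \<open>A node listed on another side can lie on side \<open>s\<close> only at a vertex, and the
  vertices are undisplaced nodes of both sides that contain them.\<close>

lemma boundary_nodes_Int_side: "boundary_nodes m n \<delta> \<inter> side_segment m n s = side_point m n s ` positions s"
proof
  have "0 \<in> positions t" "real (num_parts m n t) \<in> positions t"
    "positions t \<subseteq> {0..real (num_parts m n t)}" for t
    by (fact positions_0 positions_last positions_subset)+
  note P = this[of Left_Side] this[of Right_Side] this[of Bottom_Side] this[of Top_Side]
  show "boundary_nodes m n \<delta> \<inter> side_segment m n s \<subseteq> side_point m n s ` positions s"
    unfolding boundary_nodes_explicit
    using P pos by (cases s) (auto simp: side_segment_def)
  show "side_point m n s ` positions s \<subseteq> boundary_nodes m n \<delta> \<inter> side_segment m n s"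
    unfolding boundary_nodes_eq side_segment_def using positions_subset by blast
qed

lemma card_boundary_nodes_Int_side:
  "card (boundary_nodes m n \<delta> \<inter> side_segment m n s) = num_parts m n s + 1"
proof -
  have "inj (side_point m n s)" by (cases s) (auto simp: inj_def)
  then show ?thesis
    by (simp add: boundary_nodes_Int_side card_image positions_card inj_on_subset)
qed

lemma card_boundary_nodes: "card (boundary_nodes m n \<delta>) = 2 * (m + n)"
proof -
  \<comment> \<open>The vertices are assigned to the vertical sides only, so each is counted once:
    2(m+1) + 2(n-1).\<close>
  define V where "V = {0} \<times> positions Left_Side \<union> {real n} \<times> positions Right_Side"
  define H where "H = (positions Bottom_Side - {0, real n}) \<times> {0::real} \<union>
     (positions Top_Side - {0, real n}) \<times> {real m}"
  have "0 \<in> positions t" "real (num_parts m n t) \<in> positions t"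
    "positions t \<subseteq> {0..real (num_parts m n t)}" for t
    by (fact positions_0 positions_last positions_subset)+
  note P = this[of Left_Side] this[of Right_Side] this[of Bottom_Side] this[of Top_Side]
  have B: "boundary_nodes m n \<delta> = V \<union> H"
    unfolding boundary_nodes_explicit V_def H_def using P by auto
  have "card V = card ({0::real} \<times> positions Left_Side) + card ({real n} \<times> positions Right_Side)"
    unfolding V_def using pos positions_finite by (intro card_Un_disjoint) auto
  then have V: "card V = 2 * (m + 1)"
    by (simp add: card_cartesian_product positions_card)
  have "card H = card ((positions Bottom_Side - {0, real n}) \<times> {0::real}) +
      card ((positions Top_Side - {0, real n}) \<times> {real m})"
    unfolding H_def using pos positions_finite by (intro card_Un_disjoint) auto
  then have H: "card H = 2 * (n - 1)"
    using P pos by (simp add: card_cartesian_product positions_card card_Diff_subset)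
  have "card (V \<union> H) = card V + card H"
    using pos positions_finite unfolding V_def H_def by (intro card_Un_disjoint) auto
  then show ?thesis using V H B pos by simp
qed

text \<open>Adjacent sides meet in one vertex and opposite sides not at all; this is the smallness
  hypothesis of \<open>card_4_subsets_spread\<close>.\<close>

lemma card_side_Int_side:
  assumes "s \<noteq> t"
  shows "card (boundary_nodes m n \<delta> \<inter> side_segment m n s \<inter> side_segment m n t) \<le> 1"
proof -
  have "\<forall>p\<in>side_segment m n s \<inter> side_segment m n t. \<forall>q\<in>side_segment m n s \<inter> side_segment m n t. p = q"
    using assms pos by (cases s; cases t) (auto simp: side_segment_def)
  then show ?thesis
    using finite_boundary_nodes by (subst One_nat_def, subst card_le_Suc0_iff_eq) auto
qed

end

section \<open>From binomial coefficients to the closed formula\<close>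

lemma node_count_closed_form:
  fixes m n g :: nat
  assumes "m \<ge> 1" "n \<ge> 1"
    and "g + 2 * ((m + 1 choose 3) * (2 * (m + n) - (m + 1)) + (m + 1 choose 4))
      + 2 * ((n + 1 choose 3) * (2 * (m + n) - (n + 1)) + (n + 1 choose 4)) = 2 * (m + n) choose 4"
  shows "real g = 1 / 4 * ((real m + real n) * (real m + real n - 1) ^ 2 * (real m + real n - 4)
             + 2 * real m * real n * (2 * real m + real n - 1) * (real m + 2 * real n - 1))"
proof -
  \<comment> \<open>The natural-number differences are exact because \<open>m\<close> and
    \<open>n\<close> are at least 1.\<close>
  have "real (2 * (m + n) - (m + 1)) = real m + 2 * real n - 1"
    and "real (2 * (m + n) - (n + 1)) = 2 * real m + real n - 1"
    using assms(1,2) by (simp_all add: of_nat_diff)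
  with arg_cong[OF assms(3), of real]
  have "real g + 2 * (real (m + 1 choose 3) * (real m + 2 * real n - 1) + real (m + 1 choose 4))
      + 2 * (real (n + 1 choose 3) * (2 * real m + real n - 1) + real (n + 1 choose 4))
      = real (2 * (m + n) choose 4)"
    by (simp only: of_nat_add of_nat_mult of_nat_numeral)
  then show ?thesis
    unfolding real_choose_3 real_choose_4 by (simp add: field_simps power2_eq_square)
qed

theorem theorem7p1:
  fixes m n :: nat and \<delta> :: "side \<Rightarrow> nat \<Rightarrow> real"
  assumes "m \<ge> 1" and "n \<ge> 1"
    and "general_position m n \<delta>"
  shows "real (card (interior_nodes m n \<delta>)) =
    1 / 4 * ((real m + real n) * (real m + real n - 1) ^ 2 * (real m + real n - 4)
             + 2 * real m * real n * (2 * real m + real n - 1) * (real m + 2 * real n - 1))"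
proof -
  let ?K = "rectangle m n" and ?F = "side_segment m n" and ?B = "boundary_nodes m n \<delta>"
  have gp: "card {c \<in> chords m n \<delta>. x \<in> c} < 3" if "x \<in> interior ?K" for x
    using assms(3) that unfolding general_position_def by (auto simp: not_le)
  have adm: "admissible_displacement m n \<delta>"
    using assms(3) by (simp add: general_position_def)
  interpret polygon_sides ?K ?F
  proof
    show "convex ?K" by (simp add: rectangle_def)
  qed (fact side_segment_face rectangle_boundary)+
  note nodes = assms(1,2) adm
  have finite_side: "finite (UNIV :: side set)" by (simp add: UNIV_side)
  define G where "G = {S. S \<subseteq> ?B \<and> card S = 4 \<and> (\<forall>s. card (S \<inter> ?F s) \<le> 2)}"
  have nodes_G: "card (interior_nodes m n \<delta>) = card G"
    unfolding G_def interior_nodes_def chords_def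
    using finite_boundary_nodes[OF nodes] boundary_nodes_subset[OF nodes]
    by (intro card_crossing_points gp[unfolded chords_def]) simp_all
  have "card G + (\<Sum>s\<in>UNIV. (card (?B \<inter> ?F s) choose 3) * (card ?B - card (?B \<inter> ?F s))
      + (card (?B \<inter> ?F s) choose 4)) = card ?B choose 4"
    unfolding G_def
    using card_4_subsets_spread[OF finite_boundary_nodes[OF nodes] finite_side, of ?F]
      card_side_Int_side[OF nodes] by simp
  then have "card G + (\<Sum>s\<in>UNIV. (num_parts m n s + 1 choose 3) * (2 * (m + n) - (num_parts m n s + 1))
      + (num_parts m n s + 1 choose 4)) = 2 * (m + n) choose 4"
    by (simp only: card_boundary_nodes_Int_side[OF nodes] card_boundary_nodes[OF nodes])
  \<comment> \<open>Opposite sides have equally many nodes, which gives the two factors 2.\<close>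
  then have "card G + 2 * ((m + 1 choose 3) * (2 * (m + n) - (m + 1)) + (m + 1 choose 4))
      + 2 * ((n + 1 choose 3) * (2 * (m + n) - (n + 1)) + (n + 1 choose 4)) = 2 * (m + n) choose 4"
    by (simp add: UNIV_side)
  from node_count_closed_form[OF assms(1,2) this] show ?thesis by (simp add: nodes_G)
qed

end
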